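(* Let $(S,+,0,\bullet,1)$ be a partial commutative semiring satisfying the standing assumptions below, let $FX=\coprod_{\lambda\in\Lambda}X^{\mathrm{ar}(\lambda)}$ and let $(C,\gamma)$ be a $\mathsf{T}_S\circ F$-coalgebra. If $c,d\in C$ are linear time equivalent, i.e. $\mathsf{lt}_\gamma(c,b)=\mathsf{lt}_\gamma(d,b)$ for every trace fragment $b$, then $[\![\varphi]\!]_\gamma(c)=[\![\varphi]\!]_\gamma(d)$ for every closed formula $\varphi\in\mu\mathcal{L}^0_\Lambda$.
   Context: A partial commutative semiring is a tuple $(S,+,0,\bullet,1)$ where $+$ is a partial binary operation on $S$, commutative and associative whenever defined, with unit $0$; $(S,\bullet,1)$ is a commutative monoid; $s\bullet 0=0$; and whenever $t+u$ is defined, $s\bullet t+s\bullet u$ is defined and equals $s\bullet(t+u)$. Define $x\sqsubseteq y$ iff $x+z=y$ for some $z$. Standing assumptions: $\sqsubseteq$ is a partial order in which increasing $\omega$-chains have suprema and decreasing $\omega$-chains have infima, $1$ is the top element, $+$ and $\bullet$ preserve suprema of increasing and infima of decreasing $\omega$-chains in each argument; and $(S,\sqsubseteq)$ is a complete lattice. $S$-valued functions are ordered pointwise. $\mathsf{T}_SX$ is the set of finitely supported $\varphi:X\to S$ whose sum of values is defined; $\Lambda$ is a set of symbols with arities $\mathrm{ar}(\lambda)\in\mathbb N$, elements of $FX$ are written $\iota_\lambda(x_1,\dots,x_{\mathrm{ar}(\lambda)})$, and a $\mathsf{T}_S\circ F$-coalgebra is a map $\gamma:C\to\mathsf{T}_S(FC)$.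 The $\nu$-extent $\mathsf{ext}_\gamma:C\to S$ is the greatest fixpoint of the operator on $S^C$ sending $p$ to $c\mapsto\sum_{\lambda}\sum_{(c_1,\dots,c_n),\,n=\mathrm{ar}(\lambda)}\gamma(c)(\iota_\lambda(c_1,\dots,c_n))\bullet p(c_1)\bullet\cdots\bullet p(c_n)$ (finite sum over the support of $\gamma(c)$; empty products are $1$). Logic: formulas $\varphi::=\top\mid x\mid[\lambda](\varphi_1,\dots,\varphi_{\mathrm{ar}(\lambda)})\mid\sum_{i\in I}c_i\bullet\varphi_i\mid\mu x.\varphi\mid\nu x.\varphi$ ($x$ a variable, $I$ finite, $c_i\in S$ with $\sum_i c_i$ defined); $\bot$ is the empty sum. $\mu\mathcal L^0_\Lambda$: closed formulas with no weighted sums other than $\bot$. Step-wise semantics under a valuation $V$ of variables in $S^C$: $[\![\top]\!]=\mathsf{ext}_\gamma$; $[\![x]\!]=V(x)$; $[\![\sum_ic_i\bullet\varphi_i]\!](c)=\sum_ic_i\bullet[\![\varphi_i]\!](c)$; $[\![[\lambda](\varphi_1,\dots,\varphi_n)]\!](c)=\sum_{(c_1,\dots,c_n)}\gamma(c)(\iota_\lambda(c_1,\dots,c_n))\bullet[\![\varphi_1]\!](c_1)\bullet\cdots\bullet[\![\varphi_n]\!](c_n)$; $\mu x.\varphi$ / $\nu x.\varphi$ are interpreted as least / greatest fixpoints of $p\mapsto[\![\varphi]\!]^{V[p/x]}$. Trace fragments: the elements of the initial algebra of $X\mapsto 1+FX$, i.e. finite ordered trees whose nodes are labelled either by $\lambda\in\Lambda$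 with exactly $\mathrm{ar}(\lambda)$ children, or by a special symbol $[]$ (a leaf, the empty trace fragment). The linear time behaviour $\mathsf{lt}_\gamma:C\times B\to S$ ($B$ the set of trace fragments) is the greatest fixpoint of the operator on $S^{C\times B}$ sending $R$ to the function with $(c,[])\mapsto\mathsf{ext}_\gamma(c)$ and $(c,\lambda(b_1,\dots,b_n))\mapsto\sum_{(c_1,\dots,c_n)}\gamma(c)(\iota_\lambda(c_1,\dots,c_n))\bullet R(c_1,b_1)\bullet\cdots\bullet R(c_n,b_n)$.
   Formalization: The formal theorem additionally assumes that in every subformula νx.φ the variable x occurs only under a modality; without this the claim fails, e.g. for [λ](νx.x) over the Booleans, which detects transitions into states of extent 0. *)

theory Defs
  imports Main
begin

section \<open>Partial commutative semirings\<close>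

text \<open>The carrier is the whole type \<open>'s\<close>; \<open>None\<close> is an undefined sum.\<close>

record 's psemiring =
  add :: "'s \<Rightarrow> 's \<Rightarrow> 's option"
  zero :: 's
  mult :: "'s \<Rightarrow> 's \<Rightarrow> 's"
  one :: 's

locale partial_comm_semiring =
  fixes S :: "'s psemiring"
  assumes add_commute: "add S x y = add S y x"
    and add_assoc:
      "Option.bind (add S x y) (\<lambda>w. add S w z) = Option.bind (add S y z) (\<lambda>w. add S x w)"
    and add_zero: "add S x (zero S) = Some x"
    and mult_comm_monoid: "comm_monoid (mult S) (one S)"
    and mult_zero: "mult S s (zero S) = zero S"
    and distrib: "add S t u = Some v \<Longrightarrow> add S (mult S s t) (mult S s u) = Some (mult S s v)"

definition sle :: "'s psemiring \<Rightarrow> 's \<Rightarrow> 's \<Rightarrow> bool" where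
  "sle S x y \<longleftrightarrow> (\<exists>z. add S x z = Some y)"

definition is_sup :: "'s psemiring \<Rightarrow> 's set \<Rightarrow> 's \<Rightarrow> bool" where
  "is_sup S A s \<longleftrightarrow> (\<forall>x\<in>A. sle S x s) \<and> (\<forall>u. (\<forall>x\<in>A. sle S x u) \<longrightarrow> sle S s u)"

definition is_inf :: "'s psemiring \<Rightarrow> 's set \<Rightarrow> 's \<Rightarrow> bool" where
  "is_inf S A s \<longleftrightarrow> (\<forall>x\<in>A. sle S s x) \<and> (\<forall>u. (\<forall>x\<in>A. sle S u x) \<longrightarrow> sle S u s)"

definition inc_chain :: "'s psemiring \<Rightarrow> (nat \<Rightarrow> 's) \<Rightarrow> bool" where
  "inc_chain S X \<longleftrightarrow> (\<forall>n. sle S (X n) (X (Suc n)))"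

definition dec_chain :: "'s psemiring \<Rightarrow> (nat \<Rightarrow> 's) \<Rightarrow> bool" where
  "dec_chain S X \<longleftrightarrow> (\<forall>n. sle S (X (Suc n)) (X n))"

text \<open>Both operations are commutative, so preservation is stated for the second argument only.
  Since addition is partial, preserving the limit of a chain of defined sums includes
  definedness of the limit sum.\<close>

locale continuous_semiring = partial_comm_semiring S for S :: "'s psemiring" +
  assumes sle_refl: "reflp (sle S)"
    and sle_trans: "transp (sle S)"
    and sle_antisym: "antisymp (sle S)"
    and inc_chain_sup: "inc_chain S X \<Longrightarrow> \<exists>s. is_sup S (range X) s"
    and dec_chain_inf: "dec_chain S X \<Longrightarrow> \<exists>s. is_inf S (range X) s"
    and one_top: "sle S x (one S)"
    and add_sup: "\<lbrakk>inc_chain S X; is_sup S (range X) s; \<And>n. add S t (X n) = Some (Y n)\<rbrakk>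
      \<Longrightarrow> \<exists>u. add S t s = Some u \<and> is_sup S (range Y) u"
    and add_inf: "\<lbrakk>dec_chain S X; is_inf S (range X) s; \<And>n. add S t (X n) = Some (Y n)\<rbrakk>
      \<Longrightarrow> \<exists>u. add S t s = Some u \<and> is_inf S (range Y) u"
    and mult_sup: "\<lbrakk>inc_chain S X; is_sup S (range X) s\<rbrakk>
      \<Longrightarrow> is_sup S (range (\<lambda>n. mult S t (X n))) (mult S t s)"
    and mult_inf: "\<lbrakk>dec_chain S X; is_inf S (range X) s\<rbrakk>
      \<Longrightarrow> is_inf S (range (\<lambda>n. mult S t (X n))) (mult S t s)"
    and lattice_sup: "\<exists>s. is_sup S A s"
    and lattice_inf: "\<exists>s. is_inf S A s"

text \<open>With \<open>None\<close> absorbing, partial addition becomes a total commutative monoid on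
  \<open>'s option\<close>; a finite sum is defined iff its value there is not \<open>None\<close>.\<close>

definition oadd :: "'s psemiring \<Rightarrow> 's option \<Rightarrow> 's option \<Rightarrow> 's option" where
  "oadd S a b = Option.bind a (\<lambda>x. Option.bind b (\<lambda>y. add S x y))"

definition psum :: "'s psemiring \<Rightarrow> ('i \<Rightarrow> 's) \<Rightarrow> 'i set \<Rightarrow> 's option" where
  "psum S f A = comm_monoid_set.F (oadd S) (Some (zero S)) (\<lambda>i. Some (f i)) A"

lemma (in partial_comm_semiring) comm_monoid_set_oadd:
  "comm_monoid_set (oadd S) (Some (zero S))"
proof
  fix a b c :: "'s option"
  show "oadd S a b = oadd S b a"
    by (cases a; cases b) (auto simp: oadd_def add_commute)
  show "oadd S (oadd S a b) c = oadd S a (oadd S b c)"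
  proof (cases "a = None \<or> b = None \<or> c = None")
    case True
    then show ?thesis by (cases a; cases b) (auto simp: oadd_def)
  next
    case False
    then obtain x y z where "a = Some x" "b = Some y" "c = Some z" by auto
    then show ?thesis using add_assoc[of x y z] by (simp add: oadd_def)
  qed
  show "oadd S a (Some (zero S)) = a"
    by (cases a) (auto simp: oadd_def add_zero)
qed

definition mprod :: "'s psemiring \<Rightarrow> 's list \<Rightarrow> 's" where
  "mprod S xs = foldr (mult S) xs (one S)"


section \<open>Fixpoints\<close>

definition least_fixpoint :: "('a \<Rightarrow> 'a \<Rightarrow> bool) \<Rightarrow> ('a \<Rightarrow> 'a) \<Rightarrow> 'a" where
  "least_fixpoint le f = (THE p. f p = p \<and> (\<forall>q. f q = q \<longrightarrow> le p q))"

definition greatest_fixpoint :: "('a \<Rightarrow> 'a \<Rightarrow> bool) \<Rightarrow> ('a \<Rightarrow> 'a) \<Rightarrow> 'a" where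
  "greatest_fixpoint le f = (THE p. f p = p \<and> (\<forall>q. f q = q \<longrightarrow> le q p))"

definition fle :: "'s psemiring \<Rightarrow> ('x \<Rightarrow> 's) \<Rightarrow> ('x \<Rightarrow> 's) \<Rightarrow> bool" where
  "fle S p q \<longleftrightarrow> (\<forall>x. sle S (p x) (q x))"


section \<open>Coalgebras\<close>

text \<open>\<open>\<iota>\<^sub>\<lambda>(x\<^sub>1, \<dots>, x\<^sub>n)\<close> is the pair \<open>(\<lambda>, [x\<^sub>1, \<dots>, x\<^sub>n])\<close>.\<close>

definition Fobj :: "'l set \<Rightarrow> ('l \<Rightarrow> nat) \<Rightarrow> 'x set \<Rightarrow> ('l \<times> 'x list) set" where
  "Fobj \<Lambda> ar X = {(l, xs). l \<in> \<Lambda> \<and> length xs = ar l \<and> set xs \<subseteq> X}"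

definition supp :: "'s psemiring \<Rightarrow> ('x \<Rightarrow> 's) \<Rightarrow> 'x set" where
  "supp S f = {x. f x \<noteq> zero S}"

text \<open>A function on \<open>X\<close> is represented by its extension by zero.\<close>

definition TS :: "'s psemiring \<Rightarrow> 'x set \<Rightarrow> ('x \<Rightarrow> 's) set" where
  "TS S X = {f. supp S f \<subseteq> X \<and> finite (supp S f) \<and> psum S f (supp S f) \<noteq> None}"

type_synonym ('c, 'l, 's) coalg = "'c \<Rightarrow> 'l \<times> 'c list \<Rightarrow> 's"

definition coalgebra ::
  "'s psemiring \<Rightarrow> 'l set \<Rightarrow> ('l \<Rightarrow> nat) \<Rightarrow> ('c, 'l, 's) coalg \<Rightarrow> bool" where
  "coalgebra S \<Lambda> ar \<gamma> \<longleftrightarrow> (\<forall>c. \<gamma> c \<in> TS S (Fobj \<Lambda> ar UNIV))"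

text \<open>The sums under \<open>the\<close> below are always defined for a coalgebra: each summand lies below
  the corresponding value of \<open>\<gamma> c\<close>, because \<open>one S\<close> is the top element.\<close>

definition ext_op :: "'s psemiring \<Rightarrow> ('c, 'l, 's) coalg \<Rightarrow> ('c \<Rightarrow> 's) \<Rightarrow> 'c \<Rightarrow> 's" where
  "ext_op S \<gamma> p c =
    the (psum S (\<lambda>(l, cs). mult S (\<gamma> c (l, cs)) (mprod S (map p cs))) (supp S (\<gamma> c)))"

definition ext :: "'s psemiring \<Rightarrow> ('c, 'l, 's) coalg \<Rightarrow> 'c \<Rightarrow> 's" where
  "ext S \<gamma> = greatest_fixpoint (fle S) (ext_op S \<gamma>)"

definition modality ::
  "'s psemiring \<Rightarrow> ('c, 'l, 's) coalg \<Rightarrow> 'l \<Rightarrow> ('c \<Rightarrow> 's) list \<Rightarrow> 'c \<Rightarrow> 's" where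
  "modality S \<gamma> l ps c =
    the (psum S (\<lambda>cs. mult S (\<gamma> c (l, cs)) (mprod S (map2 (\<lambda>p c'. p c') ps cs)))
      (supp S (\<lambda>cs. \<gamma> c (l, cs))))"


section \<open>Fixpoint logic\<close>

text \<open>The weighted sum of \<open>c\<^sub>i \<bullet> \<phi>\<^sub>i\<close> over a finite index set is given by the list of the
  pairs \<open>(c\<^sub>i, \<phi>\<^sub>i)\<close>; bottom is \<open>WSum []\<close>.\<close>

datatype ('s, 'l, 'v) fm =
    Top
  | Var 'v
  | Modal 'l "('s, 'l, 'v) fm list"
  | WSum "('s \<times> ('s, 'l, 'v) fm) list"
  | Mu 'v "('s, 'l, 'v) fm"
  | Nu 'v "('s, 'l, 'v) fm"

fun wf_fm :: "'s psemiring \<Rightarrow> 'l set \<Rightarrow> ('l \<Rightarrow> nat) \<Rightarrow> ('s, 'l, 'v) fm \<Rightarrow> bool" where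
  "wf_fm S \<Lambda> ar Top \<longleftrightarrow> True"
| "wf_fm S \<Lambda> ar (Var x) \<longleftrightarrow> True"
| "wf_fm S \<Lambda> ar (Modal l \<phi>s) \<longleftrightarrow> l \<in> \<Lambda> \<and> length \<phi>s = ar l \<and> (\<forall>\<phi>\<in>set \<phi>s. wf_fm S \<Lambda> ar \<phi>)"
| "wf_fm S \<Lambda> ar (WSum ws) \<longleftrightarrow>
    psum S (\<lambda>i. fst (ws ! i)) {..<length ws} \<noteq> None \<and> (\<forall>(s, \<phi>)\<in>set ws. wf_fm S \<Lambda> ar \<phi>)"
| "wf_fm S \<Lambda> ar (Mu x \<phi>) \<longleftrightarrow> wf_fm S \<Lambda> ar \<phi>"
| "wf_fm S \<Lambda> ar (Nu x \<phi>) \<longleftrightarrow> wf_fm S \<Lambda> ar \<phi>"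

fun fv :: "('s, 'l, 'v) fm \<Rightarrow> 'v set" where
  "fv Top = {}"
| "fv (Var x) = {x}"
| "fv (Modal l \<phi>s) = (\<Union>\<phi>\<in>set \<phi>s. fv \<phi>)"
| "fv (WSum ws) = (\<Union>(s, \<phi>)\<in>set ws. fv \<phi>)"
| "fv (Mu x \<phi>) = fv \<phi> - {x}"
| "fv (Nu x \<phi>) = fv \<phi> - {x}"

fun only_bot_sums :: "('s, 'l, 'v) fm \<Rightarrow> bool" where
  "only_bot_sums Top \<longleftrightarrow> True"
| "only_bot_sums (Var x) \<longleftrightarrow> True"
| "only_bot_sums (Modal l \<phi>s) \<longleftrightarrow> (\<forall>\<phi>\<in>set \<phi>s. only_bot_sums \<phi>)"
| "only_bot_sums (WSum ws) \<longleftrightarrow> ws = []"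
| "only_bot_sums (Mu x \<phi>) \<longleftrightarrow> only_bot_sums \<phi>"
| "only_bot_sums (Nu x \<phi>) \<longleftrightarrow> only_bot_sums \<phi>"

definition muL0 :: "'s psemiring \<Rightarrow> 'l set \<Rightarrow> ('l \<Rightarrow> nat) \<Rightarrow> ('s, 'l, 'v) fm set" where
  "muL0 S \<Lambda> ar = {\<phi>. wf_fm S \<Lambda> ar \<phi> \<and> fv \<phi> = {} \<and> only_bot_sums \<phi>}"

fun unguarded_fv :: "('s, 'l, 'v) fm \<Rightarrow> 'v set" where
  "unguarded_fv Top = {}"
| "unguarded_fv (Var x) = {x}"
| "unguarded_fv (Modal l \<phi>s) = {}"
| "unguarded_fv (WSum ws) = (\<Union>(s, \<phi>)\<in>set ws. unguarded_fv \<phi>)"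
| "unguarded_fv (Mu x \<phi>) = unguarded_fv \<phi> - {x}"
| "unguarded_fv (Nu x \<phi>) = unguarded_fv \<phi> - {x}"

text \<open>The usual guardedness condition, imposed on greatest fixpoints only. Some such condition
  is needed for linear time equivalence to imply logical equivalence: \<open>\<nu>x. x\<close> denotes the
  constant function \<open>one S\<close>, which may exceed the extent, so that \<open>[\<lambda>](\<nu>x. x)\<close> detects
  transitions into states of extent zero, which no trace fragment can see.\<close>

fun nu_guarded :: "('s, 'l, 'v) fm \<Rightarrow> bool" where
  "nu_guarded Top \<longleftrightarrow> True"
| "nu_guarded (Var x) \<longleftrightarrow> True"
| "nu_guarded (Modal l \<phi>s) \<longleftrightarrow> (\<forall>\<phi>\<in>set \<phi>s. nu_guarded \<phi>)"
| "nu_guarded (WSum ws) \<longleftrightarrow> (\<forall>(s, \<phi>)\<in>set ws. nu_guarded \<phi>)"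
| "nu_guarded (Mu x \<phi>) \<longleftrightarrow> nu_guarded \<phi>"
| "nu_guarded (Nu x \<phi>) \<longleftrightarrow> x \<notin> unguarded_fv \<phi> \<and> nu_guarded \<phi>"

fun sem :: "'s psemiring \<Rightarrow> ('c, 'l, 's) coalg \<Rightarrow> ('s, 'l, 'v) fm \<Rightarrow> ('v \<Rightarrow> 'c \<Rightarrow> 's) \<Rightarrow> 'c \<Rightarrow> 's" where
  "sem S \<gamma> Top V = ext S \<gamma>"
| "sem S \<gamma> (Var x) V = V x"
| "sem S \<gamma> (Modal l \<phi>s) V = modality S \<gamma> l (map (\<lambda>\<phi>. sem S \<gamma> \<phi> V) \<phi>s)"
| "sem S \<gamma> (WSum ws) V =
    (\<lambda>c. the (psum S (\<lambda>i. map (\<lambda>(s, \<phi>). mult S s (sem S \<gamma> \<phi> V c)) ws ! i) {..<length ws}))"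
| "sem S \<gamma> (Mu x \<phi>) V = least_fixpoint (fle S) (\<lambda>p. sem S \<gamma> \<phi> (V(x := p)))"
| "sem S \<gamma> (Nu x \<phi>) V = greatest_fixpoint (fle S) (\<lambda>p. sem S \<gamma> \<phi> (V(x := p)))"


section \<open>Trace fragments\<close>

datatype 'l fragment = Empty | Node 'l "'l fragment list"

inductive_set fragments :: "'l set \<Rightarrow> ('l \<Rightarrow> nat) \<Rightarrow> 'l fragment set"
  for \<Lambda> :: "'l set" and ar :: "'l \<Rightarrow> nat" where
  "Empty \<in> fragments \<Lambda> ar"
| "\<lbrakk>l \<in> \<Lambda>; length bs = ar l; \<forall>b\<in>set bs. b \<in> fragments \<Lambda> ar\<rbrakk> \<Longrightarrow> Node l bs \<in> fragments \<Lambda> ar"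

text \<open>The operator is defined on all labelled trees. Its value at a tree in \<open>fragments \<Lambda> ar\<close>
  depends only on subtrees, which are again in \<open>fragments \<Lambda> ar\<close>, so restricting the fixpoint
  to those gives the fixpoint on them.\<close>

fun lt_op :: "'s psemiring \<Rightarrow> ('c, 'l, 's) coalg \<Rightarrow>
    ('c \<times> 'l fragment \<Rightarrow> 's) \<Rightarrow> 'c \<times> 'l fragment \<Rightarrow> 's" where
  "lt_op S \<gamma> R (c, Empty) = ext S \<gamma> c"
| "lt_op S \<gamma> R (c, Node l bs) = modality S \<gamma> l (map (\<lambda>b c'. R (c', b)) bs) c"

definition lt :: "'s psemiring \<Rightarrow> ('c, 'l, 's) coalg \<Rightarrow> 'c \<times> 'l fragment \<Rightarrow> 's" where
  "lt S \<gamma> = greatest_fixpoint (fle S) (lt_op S \<gamma>)"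

definition lt_equiv ::
  "'s psemiring \<Rightarrow> 'l set \<Rightarrow> ('l \<Rightarrow> nat) \<Rightarrow> ('c, 'l, 's) coalg \<Rightarrow> 'c \<Rightarrow> 'c \<Rightarrow> bool" where
  "lt_equiv S \<Lambda> ar \<gamma> c d \<longleftrightarrow> (\<forall>b\<in>fragments \<Lambda> ar. lt S \<gamma> (c, b) = lt S \<gamma> (d, b))"

end

theory Submission
  imports Defs
begin

text \<open>When bottom is the only sum, the semantics is strict in every free variable, so a least
  fixpoint is either zero or vacuous. Guardedness keeps greatest fixpoints below the extent, which
  is therefore a legitimate starting point for their iteration. Unfolding every greatest fixpoint
  \<open>n\<close> times from the extent turns a closed formula into zero or into \<open>lt S \<gamma> (_, b)\<close> for a trace
  fragment \<open>b\<close>, the truncated fixpoints becoming empty fragments, and by continuity along decreasing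
  chains the formula denotes the infimum over \<open>n\<close>.\<close>

section \<open>Order and sums in a partial commutative semiring\<close>

context partial_comm_semiring
begin

text \<open>Finite partial sums live in the total monoid on \<open>'s option\<close>, so regrouping,
  splitting and reindexing are inherited from \<open>comm_monoid_set\<close>.\<close>

sublocale osum: comm_monoid_set "oadd S" "Some (zero S)"
  by (rule comm_monoid_set_oadd)

sublocale mult: comm_monoid "mult S" "one S"
  by (rule mult_comm_monoid)

lemma oadd_Some [simp]: "oadd S (Some x) (Some y) = add S x y"
  by (simp add: oadd_def)

lemma oadd_eq_SomeE:
  assumes "oadd S a b = Some v"
  obtains x y where "a = Some x" "b = Some y" "add S x y = Some v"
  using assms by (cases a; cases b) (auto simp: oadd_def)

lemma psum_empty [simp]: "psum S f {} = Some (zero S)"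
  by (simp add: psum_def)

lemma psum_insert:
  "finite A \<Longrightarrow> a \<notin> A \<Longrightarrow> psum S f (insert a A) = oadd S (Some (f a)) (psum S f A)"
  by (simp add: psum_def)

lemma zero_le: "sle S (zero S) x"
  using add_zero[of x] by (auto simp: sle_def add_commute)

text \<open>With \<open>a\<close> and \<open>b\<close> the differences, regroup
  \<open>(x + a) + (y + b)\<close> as \<open>(x + y) + (a + b)\<close> in the total monoid. As
  \<open>None\<close> is absorbing, definedness of the whole forces definedness of
  \<open>x + y\<close>.\<close>

lemma add_mono:
  assumes "sle S x x'" "sle S y y'" "add S x' y' = Some v"
  shows "\<exists>u. add S x y = Some u \<and> sle S u v"
proof -
  obtain a b where a: "add S x a = Some x'" and b: "add S y b = Some y'"
    using assms by (auto simp: sle_def)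
  have "oadd S (oadd S (Some x) (Some y)) (oadd S (Some a) (Some b))
      = oadd S (oadd S (Some x) (Some a)) (oadd S (Some y) (Some b))"
    by (simp only: osum.assoc osum.left_commute)
  also have "\<dots> = Some v"
    using a b assms by simp
  finally show ?thesis
    by (elim oadd_eq_SomeE) (auto simp: sle_def)
qed

lemma psum_mono:
  assumes "finite A" "\<And>i. i \<in> A \<Longrightarrow> sle S (f i) (g i)" "psum S g A = Some v"
  shows "\<exists>u. psum S f A = Some u \<and> sle S u v"
  using assms
proof (induction A arbitrary: v rule: finite_induct)
  case empty
  then show ?case using zero_le by auto
next
  case (insert a A)
  then obtain w where w: "psum S g A = Some w" "add S (g a) w = Some v"
    by (auto simp: psum_insert elim: oadd_eq_SomeE)
  with insert obtain u where u: "psum S f A = Some u" "sle S u w"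
    by blast
  show ?case
    using add_mono[OF _ u(2) w(2), of "f a"] insert u by (auto simp: psum_insert)
qed

lemma psum_subset:
  assumes "finite A" "B \<subseteq> A" "psum S f A = Some v"
  shows "\<exists>u. psum S f B = Some u \<and> sle S u v"
proof -
  have "psum S f A = oadd S (psum S f (A - B)) (psum S f B)"
    unfolding psum_def by (rule osum.subset_diff) (use assms in auto)
  then show ?thesis
    using assms(3) by (metis oadd_eq_SomeE add_commute sle_def)
qed

lemma mult_mono_right: "sle S x y \<Longrightarrow> sle S (mult S t x) (mult S t y)"
  unfolding sle_def using distrib by blast

lemma mult_zero_left: "mult S (zero S) s = zero S"
  using mult_zero mult.commute by metis

lemma mprod_Nil [simp]: "mprod S [] = one S"
  and mprod_Cons [simp]: "mprod S (x # xs) = mult S x (mprod S xs)"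
  by (simp_all add: mprod_def)

lemma mprod_zero: "zero S \<in> set xs \<Longrightarrow> mprod S xs = zero S"
  by (induction xs) (auto simp: mult_zero mult_zero_left)

end

section \<open>Limits of decreasing chains\<close>

text \<open>The chain condition and the infimum are bundled so that limit rules compose along the
  structure of products, sums and formulas.\<close>

definition dlim :: "'s psemiring \<Rightarrow> (nat \<Rightarrow> 's) \<Rightarrow> 's \<Rightarrow> bool" where
  "dlim S X s \<longleftrightarrow> dec_chain S X \<and> is_inf S (range X) s"

text \<open>The common shape of \<open>ext_op\<close> and \<open>modality\<close>, for which
  monotonicity and continuity are proved once.\<close>

definition wsum :: "'s psemiring \<Rightarrow> ('i \<Rightarrow> 's) \<Rightarrow> ('i \<Rightarrow> 's) \<Rightarrow> 's" where
  "wsum S w g = the (psum S (\<lambda>i. mult S (w i) (g i)) (supp S w))"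

context continuous_semiring
begin

lemma le_refl [simp]: "sle S x x"
  using sle_refl by (simp add: reflp_def)

lemma le_trans: "sle S x y \<Longrightarrow> sle S y z \<Longrightarrow> sle S x z"
  using sle_trans by (meson transpD)

lemma le_antisym: "sle S x y \<Longrightarrow> sle S y x \<Longrightarrow> x = y"
  using sle_antisym by (meson antisympD)

section \<open>Fixpoints in the pointwise order\<close>

lemma fle_refl [simp]: "fle S p p"
  by (simp add: fle_def)

lemma fle_trans: "fle S p q \<Longrightarrow> fle S q r \<Longrightarrow> fle S p r"
  unfolding fle_def using le_trans by blast

lemma fle_antisym: "fle S p q \<Longrightarrow> fle S q p \<Longrightarrow> p = q"
  unfolding fle_def using le_antisym by blast

lemma greatest_fixpoint_eqI:
  assumes "f p = p" "\<And>q. f q = q \<Longrightarrow> fle S q p"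
  shows "greatest_fixpoint (fle S) f = p"
  unfolding greatest_fixpoint_def using assms fle_antisym by (intro the_equality) blast+

lemma least_fixpoint_eqI:
  assumes "f p = p" "\<And>q. f q = q \<Longrightarrow> fle S p q"
  shows "least_fixpoint (fle S) f = p"
  unfolding least_fixpoint_def using assms fle_antisym by (intro the_equality) blast+

text \<open>Knaster-Tarski: the pointwise supremum \<open>s\<close> of all post-fixed points is
  post-fixed, hence so is \<open>f s\<close>, which gives \<open>f s = s\<close>. The second claim
  is the resulting coinduction principle.\<close>

lemma greatest_fixpoint_mono:
  fixes f :: "('x \<Rightarrow> 's) \<Rightarrow> 'x \<Rightarrow> 's"
  assumes mono: "\<And>p q. fle S p q \<Longrightarrow> fle S (f p) (f q)"
  shows "f (greatest_fixpoint (fle S) f) = greatest_fixpoint (fle S) f"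
    and "fle S q (f q) \<Longrightarrow> fle S q (greatest_fixpoint (fle S) f)"
proof -
  define P where "P = {q. fle S q (f q)}"
  have "\<forall>x. \<exists>s. is_sup S ((\<lambda>q. q x) ` P) s"
    using lattice_sup by blast
  then obtain s where s: "\<And>x. is_sup S ((\<lambda>q. q x) ` P) (s x)"
    by metis
  have ub: "fle S q s" if "q \<in> P" for q
    using s that unfolding fle_def is_sup_def by blast
  have least: "fle S s u" if "\<And>q. q \<in> P \<Longrightarrow> fle S q u" for u
    using s that unfolding fle_def is_sup_def by blast
  have "fle S q (f s)" if "q \<in> P" for q
    using that mono[OF ub[OF that]] fle_trans unfolding P_def by blast
  then have post: "fle S s (f s)"
    by (rule least)
  then have "f s \<in> P"
    using mono unfolding P_def by blast
  with post have fixed: "f s = s"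
    using ub fle_antisym by blast
  have eq: "greatest_fixpoint (fle S) f = s"
  proof (rule greatest_fixpoint_eqI, rule fixed)
    fix q assume "f q = q"
    then show "fle S q s" by (intro ub) (simp add: P_def)
  qed
  show "f (greatest_fixpoint (fle S) f) = greatest_fixpoint (fle S) f"
    using eq fixed by simp
  show "fle S q (greatest_fixpoint (fle S) f)" if "fle S q (f q)"
    using that eq ub unfolding P_def by simp
qed

section \<open>Continuity of products and sums along decreasing chains\<close>

lemma dec_chain_antimono:
  assumes "dec_chain S X" "m \<le> n"
  shows "sle S (X n) (X m)"
  using assms(2)
proof (induction n rule: dec_induct)
  case (step n)
  then show ?case
    using assms(1) le_trans unfolding dec_chain_def by blast
qed simp

lemma dlim_lower: "dlim S X s \<Longrightarrow> sle S s (X n)"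
  by (auto simp: dlim_def is_inf_def)

lemma dlim_greatest: "dlim S X s \<Longrightarrow> (\<And>n. sle S u (X n)) \<Longrightarrow> sle S u s"
  by (auto simp: dlim_def is_inf_def)

lemma dlimI:
  assumes "\<And>n. sle S (X (Suc n)) (X n)" "\<And>n. sle S s (X n)"
    "\<And>u. (\<And>n. sle S u (X n)) \<Longrightarrow> sle S u s"
  shows "dlim S X s"
  using assms by (auto simp: dlim_def dec_chain_def is_inf_def)

lemma dlim_dec: "dlim S X s \<Longrightarrow> sle S (X (Suc n)) (X n)"
  by (simp add: dlim_def dec_chain_def)

lemma dlim_unique: "dlim S X s \<Longrightarrow> dlim S X t \<Longrightarrow> s = t"
  by (meson dlim_lower dlim_greatest le_antisym)

lemma dlim_const: "dlim S (\<lambda>n. s) s"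
  by (rule dlimI) auto

lemma dlim_exists:
  assumes "\<And>n. sle S (X (Suc n)) (X n)"
  shows "\<exists>s. dlim S X s"
  using dec_chain_inf[of X] assms unfolding dlim_def dec_chain_def by blast

text \<open>The family decreases in both indices, so every entry \<open>f n m\<close> lies above the
  diagonal entry at \<open>max n m\<close>: a lower bound of the diagonal bounds the whole
  family.\<close>

lemma dlim_diagonal:
  assumes "\<And>n. dlim S (f n) (g n)" "dlim S g h" "\<And>m. dec_chain S (\<lambda>n. f n m)"
  shows "dlim S (\<lambda>n. f n n) h"
proof (rule dlimI)
  fix n
  show "sle S (f (Suc n) (Suc n)) (f n n)"
    using assms(1)[of "Suc n"] assms(3)[of n] le_trans
    unfolding dlim_def dec_chain_def by blast
  show "sle S h (f n n)"
    using dlim_lower[OF assms(2)] dlim_lower[OF assms(1)] le_trans by blast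
next
  fix u assume u: "\<And>n. sle S u (f n n)"
  have "sle S u (f n m)" for n m
  proof -
    have "sle S (f (max n m) (max n m)) (f n (max n m))"
      using dec_chain_antimono[OF assms(3)[of "max n m"]] by simp
    moreover have "sle S (f n (max n m)) (f n m)"
      using assms(1) dec_chain_antimono unfolding dlim_def by simp
    ultimately show ?thesis
      using u le_trans by blast
  qed
  then show "sle S u h"
    using assms dlim_greatest by meson
qed

text \<open>The axioms give continuity in each argument separately; the diagonal turns it into joint
  continuity.\<close>

lemma dlim_mult:
  assumes X: "dlim S X s" and Y: "dlim S Y t"
  shows "dlim S (\<lambda>n. mult S (X n) (Y n)) (mult S s t)"
proof (rule dlim_diagonal[where f = "\<lambda>n m. mult S (X n) (Y m)"])
  have dlim_mult_right: "dlim S (\<lambda>n. mult S r (Z n)) (mult S r z)" if "dlim S Z z" for Z z r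
    using that mult_inf mult_mono_right unfolding dlim_def dec_chain_def by blast
  show "dlim S (\<lambda>m. mult S (X n) (Y m)) (mult S (X n) t)" for n
    by (rule dlim_mult_right[OF Y])
  have left: "dlim S (\<lambda>n. mult S (X n) r) (mult S s r)" for r
    using dlim_mult_right[OF X, of r] by (simp add: mult.commute)
  show "dlim S (\<lambda>n. mult S (X n) t) (mult S s t)"
    by (rule left)
  show "dec_chain S (\<lambda>n. mult S (X n) (Y m))" for m
    using left unfolding dlim_def by blast
qed

lemma dlim_add:
  assumes X: "dlim S X s" and Y: "dlim S Y t" and Z: "\<And>n. add S (X n) (Y n) = Some (Z n)"
  shows "\<exists>u. add S s t = Some u \<and> dlim S Z u"
proof -
  have dlim_add_right: "\<exists>u. add S r a = Some u \<and> dlim S B u"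
    if "dlim S A a" "\<And>n. add S r (A n) = Some (B n)" for A B a r
  proof -
    have "sle S (B (Suc n)) (B n)" for n
      using add_mono[of r r "A (Suc n)" "A n"] that dlim_dec by fastforce
    then show ?thesis
      using add_inf[of A a r B] that unfolding dlim_def dec_chain_def by blast
  qed
  have "\<exists>u. add S (X n) (Y m) = Some u" for n m
    using add_mono[of "X n" "X 0" "Y m" "Y 0"] Z[of 0] dec_chain_antimono X Y
    unfolding dlim_def by blast
  then obtain f where f: "\<And>n m. add S (X n) (Y m) = Some (f n m)"
    by metis
  have "\<forall>n. \<exists>u. add S (X n) t = Some u \<and> dlim S (f n) u"
    using dlim_add_right[OF Y f] by blast
  then obtain g where g: "\<And>n. add S (X n) t = Some (g n)" "\<And>n. dlim S (f n) (g n)"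
    by metis
  obtain h where h: "add S t s = Some h" "dlim S g h"
    using dlim_add_right[OF X, of t g] g(1) add_commute by metis
  have "dec_chain S (\<lambda>n. f n m)" for m
    using dlim_add_right[OF X, of "Y m" "\<lambda>n. f n m"] f add_commute unfolding dlim_def by metis
  then have "dlim S (\<lambda>n. f n n) h"
    using dlim_diagonal g(2) h(2) by blast
  moreover have "(\<lambda>n. f n n) = Z"
    using f Z by auto
  ultimately show ?thesis
    using h(1) add_commute by auto
qed

lemma dlim_psum:
  assumes "finite A" "\<And>i. i \<in> A \<Longrightarrow> dlim S (\<lambda>n. f n i) (g i)" "\<And>n. psum S (f n) A = Some (Z n)"
  shows "\<exists>u. psum S g A = Some u \<and> dlim S Z u"
  using assms
proof (induction A arbitrary: Z rule: finite_induct)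
  case empty
  then have "Z = (\<lambda>n. zero S)"
    by auto
  then show ?case
    using dlim_const by simp
next
  case (insert a A)
  have "\<forall>n. \<exists>w. psum S (f n) A = Some w \<and> add S (f n a) w = Some (Z n)"
    using insert by (metis psum_insert oadd_eq_SomeE option.inject)
  then obtain W where W: "\<And>n. psum S (f n) A = Some (W n)" "\<And>n. add S (f n a) (W n) = Some (Z n)"
    by metis
  then obtain u where u: "psum S g A = Some u" "dlim S W u"
    using insert by blast
  show ?case
    using dlim_add[OF _ u(2) W(2), of "g a"] insert u(1) by (simp add: psum_insert)
qed

section \<open>Weighted sums\<close>

lemma mult_mono: "sle S x x' \<Longrightarrow> sle S y y' \<Longrightarrow> sle S (mult S x y) (mult S x' y')"
  using mult_mono_right mult.commute le_trans by metis

lemma mprod_mono: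
  assumes "\<And>i. i \<in> set is \<Longrightarrow> sle S (f i) (g i)"
  shows "sle S (mprod S (map f is)) (mprod S (map g is))"
  using assms by (induction "is") (auto intro: mult_mono)

lemma dlim_mprod:
  assumes "\<And>i. i \<in> set is \<Longrightarrow> dlim S (\<lambda>n. f n i) (g i)"
  shows "dlim S (\<lambda>n. mprod S (map (f n) is)) (mprod S (map g is))"
  using assms by (induction "is") (auto intro: dlim_mult dlim_const)

lemma mult_le_left: "sle S (mult S x y) x"
  using mult_mono_right[OF one_top, of x y] by simp

text \<open>As \<open>one S\<close> is the top element, each summand lies below its weight, and the
  sum of the weights is defined. So \<open>the\<close> in \<open>wsum\<close> is harmless.\<close>

lemma psum_weighted:
  assumes "w \<in> TS S X"
  shows "psum S (\<lambda>i. mult S (w i) (g i)) (supp S w) = Some (wsum S w g)"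
proof -
  obtain v where "psum S w (supp S w) = Some v" "finite (supp S w)"
    using assms by (auto simp: TS_def)
  then show ?thesis
    using psum_mono[of "supp S w" "\<lambda>i. mult S (w i) (g i)" w v] mult_le_left
    by (auto simp: wsum_def)
qed

lemma wsum_mono:
  assumes "w \<in> TS S X" "\<And>i. i \<in> supp S w \<Longrightarrow> sle S (g i) (h i)"
  shows "sle S (wsum S w g) (wsum S w h)"
  using psum_mono[of "supp S w" "\<lambda>i. mult S (w i) (g i)" "\<lambda>i. mult S (w i) (h i)"]
    psum_weighted[OF assms(1)] assms mult_mono_right by (auto simp: TS_def)

lemma dlim_wsum:
  assumes "w \<in> TS S X" "\<And>i. i \<in> supp S w \<Longrightarrow> dlim S (\<lambda>n. f n i) (g i)"
  shows "dlim S (\<lambda>n. wsum S w (f n)) (wsum S w g)"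
  using dlim_psum[of "supp S w" "\<lambda>n i. mult S (w i) (f n i)" "\<lambda>i. mult S (w i) (g i)"]
    psum_weighted[OF assms(1)] assms dlim_mult[OF dlim_const] by (auto simp: TS_def)

lemma wsum_zero:
  assumes "\<And>i. i \<in> supp S w \<Longrightarrow> g i = zero S"
  shows "wsum S w g = zero S"
proof -
  have "psum S (\<lambda>i. mult S (w i) (g i)) (supp S w) = Some (zero S)"
    unfolding psum_def using assms by (intro osum.neutral) (simp add: mult_zero)
  then show ?thesis
    by (simp add: wsum_def)
qed

text \<open>\<open>Pair l\<close> embeds the support of the fibre at \<open>l\<close> into the
  support of \<open>w\<close>, and a part of a defined sum is defined and smaller. This compares a
  modality, which sees one symbol, with the extent operator, which sees all.\<close>

lemma wsum_fibre:
  assumes "w \<in> TS S (Fobj \<Lambda> ar UNIV)"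
  shows "(\<lambda>cs. w (l, cs)) \<in> TS S {cs. length cs = ar l}"
    and "sle S (wsum S (\<lambda>cs. w (l, cs)) (\<lambda>cs. g (l, cs))) (wsum S w g)"
proof -
  let ?A = "supp S (\<lambda>cs. w (l, cs))"
  have inj: "inj_on (Pair l) ?A"
    by (auto simp: inj_on_def)
  have sub: "Pair l ` ?A \<subseteq> supp S w"
    by (auto simp: supp_def)
  have fin: "finite (supp S w)"
    using assms by (simp add: TS_def)
  have reindex: "psum S (\<lambda>cs. f (l, cs)) ?A = psum S f (Pair l ` ?A)" for f
    unfolding psum_def by (simp add: osum.reindex[OF inj] o_def)
  have le: "\<exists>u. psum S (\<lambda>cs. f (l, cs)) ?A = Some u \<and> sle S u v"
    if "psum S f (supp S w) = Some v" for f v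
    using psum_subset[OF fin sub that] by (simp only: reindex)
  have "?A \<subseteq> {cs. length cs = ar l}"
    using assms by (auto simp: TS_def Fobj_def supp_def)
  moreover have "finite ?A"
    using fin sub inj finite_imageD finite_subset by metis
  moreover have "psum S (\<lambda>cs. w (l, cs)) ?A \<noteq> None"
    using assms le[of w] by (auto simp: TS_def)
  ultimately show "(\<lambda>cs. w (l, cs)) \<in> TS S {cs. length cs = ar l}"
    by (simp add: TS_def)
  then show "sle S (wsum S (\<lambda>cs. w (l, cs)) (\<lambda>cs. g (l, cs))) (wsum S w g)"
    using le[of "\<lambda>i. mult S (w i) (g i)", OF psum_weighted[OF assms]]
      psum_weighted[of "\<lambda>cs. w (l, cs)" _ "\<lambda>cs. g (l, cs)"] by auto
qed

end

section \<open>Extent, modalities and linear time behaviour\<close>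

locale weighted_coalgebra = continuous_semiring S for S :: "'s psemiring" +
  fixes \<Lambda> :: "'l set" and ar :: "'l \<Rightarrow> nat" and \<gamma> :: "('c, 'l, 's) coalg"
  assumes coalg: "coalgebra S \<Lambda> ar \<gamma>"
begin

lemma coalg_TS: "\<gamma> c \<in> TS S (Fobj \<Lambda> ar UNIV)"
  using coalg by (simp add: coalgebra_def)

lemma modality_map:
  "modality S \<gamma> l (map h as) c =
    wsum S (\<lambda>cs. \<gamma> c (l, cs)) (\<lambda>cs. mprod S (map (\<lambda>(a, c'). h a c') (zip as cs)))"
  by (simp add: modality_def wsum_def zip_map1 comp_def case_prod_unfold)

lemma fibre_TS: "(\<lambda>cs. \<gamma> c (l, cs)) \<in> TS S {cs. length cs = ar l}"
  by (rule wsum_fibre(1)[OF coalg_TS])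

lemma length_fibre: "cs \<in> supp S (\<lambda>cs. \<gamma> c (l, cs)) \<Longrightarrow> length cs = ar l"
  using fibre_TS by (force simp: TS_def)

lemma modality_mono:
  assumes "\<And>a. a \<in> set as \<Longrightarrow> fle S (h a) (k a)"
  shows "fle S (modality S \<gamma> l (map h as)) (modality S \<gamma> l (map k as))"
  unfolding fle_def modality_map using assms
  by (auto intro!: wsum_mono[OF fibre_TS] mprod_mono dest: set_zip_leftD simp: fle_def)

lemma dlim_modality:
  assumes "\<And>a c. a \<in> set as \<Longrightarrow> dlim S (\<lambda>n. h n a c) (k a c)"
  shows "dlim S (\<lambda>n. modality S \<gamma> l (map (h n) as) c) (modality S \<gamma> l (map k as) c)"
  unfolding modality_map using assms
  by (auto intro!: dlim_wsum[OF fibre_TS] dlim_mprod dest: set_zip_leftD)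

text \<open>One zero factor annihilates each product. The length condition ensures that
  \<open>zip\<close> does not cut off the position of \<open>a\<close>.\<close>

lemma modality_strict:
  assumes "a \<in> set as" "h a = (\<lambda>_. zero S)" "length as = ar l"
  shows "modality S \<gamma> l (map h as) = (\<lambda>_. zero S)"
proof
  fix c
  have "mprod S (map (\<lambda>(a, c'). h a c') (zip as cs)) = zero S"
    if "cs \<in> supp S (\<lambda>cs. \<gamma> c (l, cs))" for cs
  proof -
    obtain i where i: "i < length as" "as ! i = a"
      using assms(1) by (auto simp: in_set_conv_nth)
    then have "(a, cs ! i) \<in> set (zip as cs)"
      using length_fibre[OF that] assms(3) by (auto simp: in_set_zip)
    then show ?thesis
      using assms(2) by (intro mprod_zero) force
  qed
  then show "modality S \<gamma> l (map h as) c = zero S"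
    unfolding modality_map by (rule wsum_zero)
qed

section \<open>The extent operator\<close>

lemma ext_op_wsum: "ext_op S \<gamma> p c = wsum S (\<gamma> c) (\<lambda>i. mprod S (map p (snd i)))"
  by (simp add: ext_op_def wsum_def case_prod_unfold)

lemma ext_op_mono: "fle S p q \<Longrightarrow> fle S (ext_op S \<gamma> p) (ext_op S \<gamma> q)"
  unfolding fle_def ext_op_wsum by (auto intro!: wsum_mono[OF coalg_TS] mprod_mono)

lemma dlim_ext_op:
  assumes "\<And>c. dlim S (\<lambda>n. p n c) (q c)"
  shows "dlim S (\<lambda>n. ext_op S \<gamma> (p n) c) (ext_op S \<gamma> q c)"
  unfolding ext_op_wsum using assms by (auto intro!: dlim_wsum[OF coalg_TS] dlim_mprod)

lemma ext_fixpoint: "ext_op S \<gamma> (ext S \<gamma>) = ext S \<gamma>"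
  and ext_greatest: "fle S q (ext_op S \<gamma> q) \<Longrightarrow> fle S q (ext S \<gamma>)"
  unfolding ext_def using greatest_fixpoint_mono[of "ext_op S \<gamma>", OF ext_op_mono] by auto

text \<open>A modality with all arguments equal to \<open>p\<close> is the part of the sum
  \<open>ext_op S \<gamma> p\<close> that belongs to the symbol \<open>l\<close>.\<close>

lemma modality_le_ext_op:
  assumes "length as = ar l" "\<And>a. a \<in> set as \<Longrightarrow> fle S (h a) p"
  shows "fle S (modality S \<gamma> l (map h as)) (ext_op S \<gamma> p)"
  unfolding fle_def
proof
  fix c
  have "sle S (modality S \<gamma> l (map h as) c)
      (wsum S (\<lambda>cs. \<gamma> c (l, cs)) (\<lambda>cs. mprod S (map p (snd (l, cs)))))"
    unfolding modality_map
  proof (rule wsum_mono[OF fibre_TS])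
    fix cs assume "cs \<in> supp S (\<lambda>cs. \<gamma> c (l, cs))"
    then have "map p (snd (l, cs)) = map (\<lambda>(a, c'). p c') (zip as cs)"
      using length_fibre assms(1) by (intro nth_equalityI) auto
    then show "sle S (mprod S (map (\<lambda>(a, c'). h a c') (zip as cs))) (mprod S (map p (snd (l, cs))))"
      using assms(2) by (auto intro!: mprod_mono dest: set_zip_leftD simp: fle_def)
  qed
  then show "sle S (modality S \<gamma> l (map h as) c) (ext_op S \<gamma> p c)"
    unfolding ext_op_wsum
    using wsum_fibre(2)[OF coalg_TS, of c l "\<lambda>i. mprod S (map p (snd i))"] by (rule le_trans)
qed

section \<open>Fixpoint equations of the linear time behaviour\<close>

lemma lt_op_mono: "fle S R Q \<Longrightarrow> fle S (lt_op S \<gamma> R) (lt_op S \<gamma> Q)"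
proof -
  assume le: "fle S R Q"
  have "sle S (lt_op S \<gamma> R (c, b)) (lt_op S \<gamma> Q (c, b))" for c b
  proof (cases b)
    case (Node l bs)
    have "fle S (modality S \<gamma> l (map (\<lambda>b c'. R (c', b)) bs)) (modality S \<gamma> l (map (\<lambda>b c'. Q (c', b)) bs))"
      using le by (intro modality_mono) (auto simp: fle_def)
    then show ?thesis
      using Node by (simp add: fle_def)
  qed simp
  then show ?thesis
    by (auto simp: fle_def)
qed

lemma lt_fixpoint: "lt_op S \<gamma> (lt S \<gamma>) = lt S \<gamma>"
  unfolding lt_def by (rule greatest_fixpoint_mono(1)[OF lt_op_mono])

lemma lt_Empty: "lt S \<gamma> (c, Empty) = ext S \<gamma> c"
  and lt_Node: "lt S \<gamma> (c, Node l bs) = modality S \<gamma> l (map (\<lambda>b c'. lt S \<gamma> (c', b)) bs) c"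
  using lt_fixpoint by (metis lt_op.simps(1), metis lt_op.simps(2))

section \<open>Iterates of the extent operator from the top element\<close>

definition ext_iter :: "nat \<Rightarrow> 'c \<Rightarrow> 's" where
  "ext_iter k = (ext_op S \<gamma> ^^ k) (\<lambda>_. one S)"

lemma ext_iter_0 [simp]: "ext_iter 0 = (\<lambda>_. one S)"
  and ext_iter_Suc: "ext_iter (Suc k) = ext_op S \<gamma> (ext_iter k)"
  by (simp_all add: ext_iter_def)

lemma ext_iter_dec: "fle S (ext_iter (Suc k)) (ext_iter k)"
  by (induction k) (auto simp: fle_def one_top ext_iter_Suc intro: ext_op_mono[unfolded fle_def, rule_format])

lemma ext_iter_antimono: "j \<le> k \<Longrightarrow> fle S (ext_iter k) (ext_iter j)"
  by (induction k rule: dec_induct) (auto intro: fle_trans ext_iter_dec)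

lemma ext_le_ext_iter: "fle S (ext S \<gamma>) (ext_iter k)"
proof (induction k)
  case (Suc k)
  then show ?case
    using ext_op_mono[OF Suc] by (simp add: ext_iter_Suc ext_fixpoint)
qed (simp add: fle_def one_top)

text \<open>By continuity of \<open>ext_op\<close>, the pointwise infimum \<open>q\<close> of the
  iterates is post-fixed and hence below the extent.\<close>

lemma le_extI:
  assumes "\<And>k. fle S r (ext_iter k)"
  shows "fle S r (ext S \<gamma>)"
proof -
  have dec: "sle S (ext_iter (Suc k) c) (ext_iter k c)" for k c
    using ext_iter_dec by (simp add: fle_def)
  have "\<exists>s. dlim S (\<lambda>k. ext_iter k c) s" for c
    by (rule dlim_exists) (rule dec)
  then obtain q where q: "\<And>c. dlim S (\<lambda>k. ext_iter k c) (q c)"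
    by metis
  have "dlim S (\<lambda>k. ext_iter (Suc k) c) (ext_op S \<gamma> q c)" for c
    unfolding ext_iter_Suc by (rule dlim_ext_op[OF q])
  \<comment> \<open>\<open>q\<close> is below every term of the shifted chain, hence below its limit
    \<open>ext_op S \<gamma> q\<close>.\<close>
  then have "fle S q (ext_op S \<gamma> q)"
    unfolding fle_def using q dlim_lower dlim_greatest by meson
  moreover have "fle S r q"
    using assms q dlim_greatest unfolding fle_def by blast
  ultimately show ?thesis
    using ext_greatest fle_trans by blast
qed

end

section \<open>Strictness and guardedness\<close>

lemma unguarded_fv_subset: "unguarded_fv \<phi> \<subseteq> fv \<phi>"
  by (induction \<phi>) fastforce+

context weighted_coalgebra
begin

lemma sem_cong:
  "(\<And>x. x \<in> fv \<phi> \<Longrightarrow> V x = W x) \<Longrightarrow> sem S \<gamma> \<phi> V = sem S \<gamma> \<phi> W"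
proof (induction \<phi> arbitrary: V W)
  case (Modal l \<phi>s)
  have "map (\<lambda>\<phi>. sem S \<gamma> \<phi> V) \<phi>s = map (\<lambda>\<phi>. sem S \<gamma> \<phi> W) \<phi>s"
    by (intro map_cong refl Modal.IH Modal.prems) auto
  then show ?case
    by (simp only: sem.simps)
next
  case (WSum ws)
  have "sem S \<gamma> \<phi> V = sem S \<gamma> \<phi> W" if "(s, \<phi>) \<in> set ws" for s \<phi>
    using WSum.prems that by (intro WSum.IH[OF that]) auto
  then have "map (\<lambda>(s, \<phi>). mult S s (sem S \<gamma> \<phi> V c)) ws = map (\<lambda>(s, \<phi>). mult S s (sem S \<gamma> \<phi> W c)) ws" for c
    by auto
  then show ?case
    by (simp only: sem.simps)
next
  case (Mu x \<phi>)
  have "sem S \<gamma> \<phi> (V(x := p)) = sem S \<gamma> \<phi> (W(x := p))" for p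
    using Mu.prems by (intro Mu.IH) auto
  then show ?case by simp
next
  case (Nu x \<phi>)
  have "sem S \<gamma> \<phi> (V(x := p)) = sem S \<gamma> \<phi> (W(x := p))" for p
    using Nu.prems by (intro Nu.IH) auto
  then show ?case by simp
qed auto

text \<open>Without proper sums no other summand can survive, so zero propagates through modalities.
  Under a binder of another variable the body is zero for every argument, so zero is its only
  fixpoint.\<close>

lemma sem_strict:
  "wf_fm S \<Lambda> ar \<phi> \<Longrightarrow> only_bot_sums \<phi> \<Longrightarrow> x \<in> fv \<phi> \<Longrightarrow> V x = (\<lambda>_. zero S) \<Longrightarrow>
    sem S \<gamma> \<phi> V = (\<lambda>_. zero S)"
proof (induction \<phi> arbitrary: V)
  case (Modal l \<phi>s)
  then obtain \<psi> where \<psi>: "\<psi> \<in> set \<phi>s" "x \<in> fv \<psi>"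
    by auto
  then have "sem S \<gamma> \<psi> V = (\<lambda>_. zero S)"
    using Modal by auto
  then show ?case
    using modality_strict[OF \<psi>(1)] Modal.prems by simp
next
  case (Mu y \<phi>)
  have "sem S \<gamma> \<phi> (V(y := p)) = (\<lambda>_. zero S)" for p
    using Mu.prems by (intro Mu.IH) auto
  then show ?case
    by (auto intro!: least_fixpoint_eqI)
next
  case (Nu y \<phi>)
  have "sem S \<gamma> \<phi> (V(y := p)) = (\<lambda>_. zero S)" for p
    using Nu.prems by (intro Nu.IH) auto
  then show ?case
    by (auto intro!: greatest_fixpoint_eqI)
qed auto

text \<open>If \<open>x\<close> occurs, strictness makes zero a fixpoint, necessarily the least;
  otherwise the operator is constant.\<close>

lemma sem_Mu:
  assumes "wf_fm S \<Lambda> ar \<phi>" "only_bot_sums \<phi>"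
  shows "sem S \<gamma> (Mu x \<phi>) V = (if x \<in> fv \<phi> then (\<lambda>_. zero S) else sem S \<gamma> \<phi> V)"
proof (cases "x \<in> fv \<phi>")
  case True
  then have "sem S \<gamma> \<phi> (V(x := (\<lambda>_. zero S))) = (\<lambda>_. zero S)"
    using assms by (intro sem_strict) auto
  then show ?thesis
    using True zero_le by (auto intro!: least_fixpoint_eqI simp: fle_def)
next
  case False
  then have "sem S \<gamma> \<phi> (V(x := p)) = sem S \<gamma> \<phi> V" for p
    by (intro sem_cong) auto
  then show ?thesis
    using False by (auto intro!: least_fixpoint_eqI)
qed

lemma sem_mono:
  "wf_fm S \<Lambda> ar \<phi> \<Longrightarrow> only_bot_sums \<phi> \<Longrightarrow> (\<And>x. fle S (V x) (W x)) \<Longrightarrow>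
    fle S (sem S \<gamma> \<phi> V) (sem S \<gamma> \<phi> W)"
proof (induction \<phi> arbitrary: V W)
  case (Modal l \<phi>s)
  then show ?case
    by (auto intro!: modality_mono)
next
  case (WSum ws)
  then show ?case by simp
next
  case (Mu x \<phi>)
  have "sem S \<gamma> (Mu x \<phi>) U = (if x \<in> fv \<phi> then (\<lambda>_. zero S) else sem S \<gamma> \<phi> U)" for U
    using Mu.prems by (intro sem_Mu) auto
  moreover have "fle S (sem S \<gamma> \<phi> V) (sem S \<gamma> \<phi> W)"
    using Mu by simp
  ultimately show ?case
    by (simp del: sem.simps)
next
  case (Nu x \<phi>)
  have mono: "fle S (sem S \<gamma> \<phi> (U(x := p))) (sem S \<gamma> \<phi> (U'(x := q)))"
    if "\<And>y. fle S (U y) (U' y)" "fle S p q" for U U' p q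
    using Nu.prems that by (intro Nu.IH) auto
  let ?r = "sem S \<gamma> (Nu x \<phi>) V"
  have fixed: "sem S \<gamma> \<phi> (V(x := ?r)) = ?r"
    unfolding sem.simps by (rule greatest_fixpoint_mono(1)) (rule mono, auto)
  \<comment> \<open>The fixpoint under \<open>V\<close> is post-fixed for the operator under
    \<open>W\<close>, so coinduction applies.\<close>
  have "fle S (sem S \<gamma> \<phi> (V(x := ?r))) (sem S \<gamma> \<phi> (W(x := ?r)))"
    by (rule mono[OF Nu.prems(3) fle_refl])
  then have "fle S ?r (sem S \<gamma> \<phi> (W(x := ?r)))"
    unfolding fixed .
  then show ?case
    unfolding sem.simps(6)[of S \<gamma> x \<phi> W]
    by (intro greatest_fixpoint_mono(2)) (auto intro: mono)
qed auto

lemma sem_Nu_unfold: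
  assumes "wf_fm S \<Lambda> ar \<phi>" "only_bot_sums \<phi>"
  shows "sem S \<gamma> \<phi> (V(x := sem S \<gamma> (Nu x \<phi>) V)) = sem S \<gamma> (Nu x \<phi>) V"
  unfolding sem.simps using assms by (intro greatest_fixpoint_mono(1) sem_mono) auto

text \<open>The iterates act as levels. A modality applies \<open>ext_op\<close> once more, so
  guarded variables may lag one level behind unguarded ones.\<close>

lemma sem_le_ext_iter:
  "wf_fm S \<Lambda> ar \<phi> \<Longrightarrow> only_bot_sums \<phi> \<Longrightarrow> nu_guarded \<phi> \<Longrightarrow>
    (\<And>x. x \<in> unguarded_fv \<phi> \<Longrightarrow> fle S (V x) (ext_iter (Suc k))) \<Longrightarrow>
    (\<And>x. x \<in> fv \<phi> \<Longrightarrow> fle S (V x) (ext_iter k)) \<Longrightarrow>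
    fle S (sem S \<gamma> \<phi> V) (ext_iter (Suc k))"
proof (induction \<phi> arbitrary: V k)
  case Top
  then show ?case
    using ext_le_ext_iter by simp
next
  case (Var x)
  show ?case
    by (simp add: Var.prems(4))
next
  case (Modal l \<phi>s)
  have "fle S (sem S \<gamma> \<psi> V) (ext_iter k)" if \<psi>: "\<psi> \<in> set \<phi>s" for \<psi>
  \<comment> \<open>Inside a modality level \<open>k\<close> suffices. Level \<open>0\<close> is the
    top element; for \<open>k = Suc j\<close> all variables are at level \<open>Suc j\<close>, and
    the induction hypothesis applies at \<open>j\<close>.\<close>
  proof (cases k)
    case 0
    then show ?thesis by (simp add: fle_def one_top)
  next
    case (Suc j)
    have *: "fle S (V x) (ext_iter k)" if "x \<in> fv \<psi>" for x
      using Modal.prems(5) \<psi> that by auto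
    have "unguarded_fv \<psi> \<subseteq> fv \<psi>"
      by (rule unguarded_fv_subset)
    then show ?thesis
      unfolding Suc using Modal.prems(1-3) \<psi> *
      by (intro Modal.IH) (auto simp: Suc intro: fle_trans[OF _ ext_iter_dec])
  qed
  then show ?case
    using modality_le_ext_op[of \<phi>s l "\<lambda>\<phi>. sem S \<gamma> \<phi> V"] Modal.prems
    by (simp add: ext_iter_Suc)
next
  case (WSum ws)
  then show ?case
    by (simp add: fle_def zero_le)
next
  case (Mu x \<phi>)
  have "fle S (sem S \<gamma> \<phi> V) (ext_iter (Suc k))" if "x \<notin> fv \<phi>"
  proof (rule Mu.IH)
    have "x \<notin> unguarded_fv \<phi>"
      using that unguarded_fv_subset[of \<phi>] by blast
    then show "fle S (V y) (ext_iter (Suc k))" if "y \<in> unguarded_fv \<phi>" for y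
      using that by (intro Mu.prems(4)) auto
    show "fle S (V y) (ext_iter k)" if "y \<in> fv \<phi>" for y
      using that \<open>x \<notin> fv \<phi>\<close> by (intro Mu.prems(5)) auto
  qed (use Mu.prems in auto)
  then show ?case
    using sem_Mu[of \<phi> x V] Mu.prems zero_le by (auto simp: fle_def simp del: sem.simps)
next
  case (Nu x \<phi>)
  let ?r = "sem S \<gamma> (Nu x \<phi>) V"
  \<comment> \<open>The fixpoint climbs one level per unfolding: its variable is guarded, so level
    \<open>j\<close> for it yields level \<open>Suc j\<close> for the body.\<close>
  have "j \<le> Suc k \<Longrightarrow> fle S ?r (ext_iter j)" for j
  proof (induction j)
    case 0
    then show ?case by (simp add: fle_def one_top)
  next
    case (Suc j)
    have "fle S (sem S \<gamma> \<phi> (V(x := ?r))) (ext_iter (Suc j))"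
    proof (rule Nu.IH)
      fix y assume "y \<in> unguarded_fv \<phi>"
      then have "y \<noteq> x" "y \<in> unguarded_fv (Nu x \<phi>)"
        using Nu.prems(3) by auto
      then show "fle S ((V(x := ?r)) y) (ext_iter (Suc j))"
        using fle_trans[OF Nu.prems(4) ext_iter_antimono[OF Suc.prems]] by simp
    next
      fix y assume "y \<in> fv \<phi>"
      have r: "fle S ?r (ext_iter j)"
        using Suc by simp
      have "fle S (V y) (ext_iter j)" if "y \<noteq> x"
        using that \<open>y \<in> fv \<phi>\<close> Suc.prems
        by (intro fle_trans[OF Nu.prems(5) ext_iter_antimono]) auto
      with r show "fle S ((V(x := ?r)) y) (ext_iter j)"
        by (simp del: sem.simps)
    qed (use Nu.prems in auto)
    then show ?case
      using sem_Nu_unfold[of \<phi> V x] Nu.prems by (simp del: sem.simps)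
  qed
  then show ?case by blast
qed

text \<open>Each unfolding of a guarded fixpoint gains one level, so the fixpoint lies below all
  iterates. It holds for any fixpoint, which later bounds the competitors of the greatest
  one.\<close>

lemma guarded_fixpoint_le_ext:
  assumes "wf_fm S \<Lambda> ar \<phi>" "only_bot_sums \<phi>" "nu_guarded \<phi>" "x \<notin> unguarded_fv \<phi>"
    and V: "\<And>y. fle S (V y) (ext S \<gamma>)" and r: "sem S \<gamma> \<phi> (V(x := r)) = r"
  shows "fle S r (ext S \<gamma>)"
proof (rule le_extI)
  have V': "fle S (V y) (ext_iter k)" for y k
    using V ext_le_ext_iter fle_trans by blast
  show "fle S r (ext_iter k)" for k
  proof (induction k)
    case 0
    then show ?case by (simp add: fle_def one_top)
  next
    case (Suc k)
    have "fle S (sem S \<gamma> \<phi> (V(x := r))) (ext_iter (Suc k))"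
      using assms(1-4) V' Suc by (intro sem_le_ext_iter) auto
    then show ?case
      by (simp add: r)
  qed
qed

end

section \<open>Finite approximants\<close>

text \<open>Greatest fixpoints are unfolded \<open>n\<close> times starting from the extent instead of the top
  element; the clauses for sums and least fixpoints are the closed forms that strictness gives
  when bottom is the only sum.\<close>

fun approx :: "'s psemiring \<Rightarrow> ('c, 'l, 's) coalg \<Rightarrow> nat \<Rightarrow> ('s, 'l, 'v) fm \<Rightarrow>
    ('v \<Rightarrow> 'c \<Rightarrow> 's) \<Rightarrow> 'c \<Rightarrow> 's" where
  "approx S \<gamma> n Top V = ext S \<gamma>"
| "approx S \<gamma> n (Var x) V = V x"
| "approx S \<gamma> n (Modal l \<phi>s) V = modality S \<gamma> l (map (\<lambda>\<phi>. approx S \<gamma> n \<phi> V) \<phi>s)"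
| "approx S \<gamma> n (WSum ws) V = (\<lambda>_. zero S)"
| "approx S \<gamma> n (Mu x \<phi>) V = (if x \<in> fv \<phi> then (\<lambda>_. zero S) else approx S \<gamma> n \<phi> V)"
| "approx S \<gamma> n (Nu x \<phi>) V = ((\<lambda>p. approx S \<gamma> n \<phi> (V(x := p))) ^^ n) (ext S \<gamma>)"

context weighted_coalgebra
begin

lemma funpow_fle:
  fixes F G :: "('x \<Rightarrow> 's) \<Rightarrow> 'x \<Rightarrow> 's"
  assumes "fle S p q" "\<And>p q. fle S p q \<Longrightarrow> fle S (F p) (G q)"
  shows "fle S ((F ^^ n) p) ((G ^^ n) q)"
  by (induction n) (simp_all add: assms)

lemma approx_mono:
  "(\<And>x. fle S (V x) (W x)) \<Longrightarrow> fle S (approx S \<gamma> n \<phi> V) (approx S \<gamma> n \<phi> W)"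
proof (induction \<phi> arbitrary: V W)
  case (Modal l \<phi>s)
  then show ?case
    by (auto intro!: modality_mono)
next
  case (Nu x \<phi>)
  then show ?case
    by (auto intro!: funpow_fle)
qed auto

text \<open>The extent solves its own equation, so modalities preserve being below it; hence
  iterating a body from the extent can only descend.\<close>

lemma approx_le_ext:
  "wf_fm S \<Lambda> ar \<phi> \<Longrightarrow> (\<And>x. fle S (V x) (ext S \<gamma>)) \<Longrightarrow> fle S (approx S \<gamma> n \<phi> V) (ext S \<gamma>)"
proof (induction \<phi> arbitrary: V)
  case (Modal l \<phi>s)
  then show ?case
    using modality_le_ext_op[of \<phi>s l "\<lambda>\<phi>. approx S \<gamma> n \<phi> V" "ext S \<gamma>"]
    by (simp add: ext_fixpoint)
next
  case (Nu x \<phi>)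
  have "fle S (((\<lambda>p. approx S \<gamma> n \<phi> (V(x := p))) ^^ m) (ext S \<gamma>)) (ext S \<gamma>)" for m
    using Nu by (induction m) auto
  then show ?case by simp
qed (auto simp: fle_def zero_le)

lemma approx_dec:
  "wf_fm S \<Lambda> ar \<phi> \<Longrightarrow> (\<And>x. fle S (V x) (ext S \<gamma>)) \<Longrightarrow>
    fle S (approx S \<gamma> (Suc n) \<phi> V) (approx S \<gamma> n \<phi> V)"
proof (induction \<phi> arbitrary: V)
  case (Modal l \<phi>s)
  then show ?case
    by (auto intro!: modality_mono)
next
  case (Nu x \<phi>)
  define F where "F n p = approx S \<gamma> n \<phi> (V(x := p))" for n p
  have F_ext: "fle S (F m p) (ext S \<gamma>)" if "fle S p (ext S \<gamma>)" for m p
    unfolding F_def using Nu.prems that by (intro approx_le_ext) auto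
  \<comment> \<open>First compare equally many iterations. The second conjunct supplies the bound by
    the extent that the induction hypothesis asks of the valuation.\<close>
  have le: "fle S ((F (Suc n) ^^ m) (ext S \<gamma>)) ((F n ^^ m) (ext S \<gamma>))
      \<and> fle S ((F (Suc n) ^^ m) (ext S \<gamma>)) (ext S \<gamma>)" for m
  proof (induction m)
    case (Suc m)
    let ?p = "(F (Suc n) ^^ m) (ext S \<gamma>)"
    have "fle S (F (Suc n) ?p) (F n ?p)"
      unfolding F_def using Nu Suc by (auto simp: F_def)
    moreover have "fle S (F n ?p) (F n ((F n ^^ m) (ext S \<gamma>)))"
      using Suc unfolding F_def by (auto intro: approx_mono)
    ultimately show ?case
      using Suc F_ext fle_trans by auto
  qed simp
  \<comment> \<open>The additional iteration is taken innermost, where it replaces the extent by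
    something smaller.\<close>
  have "fle S ((F (Suc n) ^^ n) (F (Suc n) (ext S \<gamma>))) ((F (Suc n) ^^ n) (ext S \<gamma>))"
    by (intro funpow_fle F_ext) (auto simp: F_def intro: approx_mono)
  then have "fle S ((F (Suc n) ^^ Suc n) (ext S \<gamma>)) ((F n ^^ n) (ext S \<gamma>))"
    unfolding funpow_Suc_right using le fle_trans by auto
  then show ?case
    unfolding approx.simps F_def .
qed auto

text \<open>The valuation varies with \<open>n\<close> because the bound variable of a greatest
  fixpoint is assigned the \<open>n\<close>-th iterate, which changes together with the
  approximation of the body.\<close>

lemma dlim_approx:
  fixes V :: "nat \<Rightarrow> 'v \<Rightarrow> 'c \<Rightarrow> 's"
  shows "wf_fm S \<Lambda> ar \<phi> \<Longrightarrow> only_bot_sums \<phi> \<Longrightarrow> nu_guarded \<phi> \<Longrightarrow>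
    (\<And>n x. fle S (V n x) (ext S \<gamma>)) \<Longrightarrow> (\<And>x c. dlim S (\<lambda>n. V n x c) (W x c)) \<Longrightarrow>
    dlim S (\<lambda>n. approx S \<gamma> n \<phi> (V n) c) (sem S \<gamma> \<phi> W c)"
proof (induction \<phi> arbitrary: V W c)
  case (Modal l \<phi>s)
  then show ?case
    unfolding approx.simps sem.simps
    by (intro dlim_modality) auto
next
  case (Mu x \<phi>)
  then have "dlim S (\<lambda>n. approx S \<gamma> n \<phi> (V n) c) (sem S \<gamma> \<phi> W c)"
    by simp
  then show ?case
    using Mu.prems by (simp add: sem_Mu dlim_const del: sem.simps)
next
  case (Nu x \<phi>)
  let ?e = "ext S \<gamma>"
  have wf: "wf_fm S \<Lambda> ar \<phi>" "only_bot_sums \<phi>" "nu_guarded \<phi>" "x \<notin> unguarded_fv \<phi>"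
    using Nu.prems by auto
  have V_dec: "fle S (V (Suc n) y) (V n y)" for n y
    using Nu.prems(5) dlim_dec unfolding fle_def by blast
  have W_V: "fle S (W y) (V n y)" for n y
    using Nu.prems(5) dlim_lower unfolding fle_def by blast
  have W_ext: "fle S (W y) ?e" for y
    using W_V Nu.prems(4) fle_trans by blast
  define F where "F n p = approx S \<gamma> n \<phi> ((V n)(x := p))" for n p
  define P where "P n = (F n ^^ n) ?e" for n
  have F_mono: "fle S p q \<Longrightarrow> fle S (F n p) (F n q)" for n p q
    unfolding F_def by (rule approx_mono) auto
  have F_ext: "fle S p ?e \<Longrightarrow> fle S (F n p) ?e" for n p
    unfolding F_def using wf Nu.prems(4) by (intro approx_le_ext) auto
  have pow_ext: "fle S ((F n ^^ m) ?e) ?e" for n m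
    by (induction m) (auto intro: F_ext)
  have F_dec: "fle S (F (Suc n) p) (F n p)" if "fle S p ?e" for n p
  proof -
    have "fle S (F (Suc n) p) (approx S \<gamma> n \<phi> ((V (Suc n))(x := p)))"
      unfolding F_def using wf Nu.prems(4) that by (intro approx_dec) auto
    moreover have "fle S (approx S \<gamma> n \<phi> ((V (Suc n))(x := p))) (F n p)"
      unfolding F_def using V_dec by (intro approx_mono) auto
    ultimately show ?thesis
      by (rule fle_trans)
  qed
  have pow_dec: "fle S ((F (Suc n) ^^ m) ?e) ((F n ^^ m) ?e)" for n m
  proof (induction m)
    case (Suc m)
    have "fle S (F (Suc n) ((F (Suc n) ^^ m) ?e)) (F n ((F (Suc n) ^^ m) ?e))"
      by (rule F_dec[OF pow_ext])
    then show ?case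
      using F_mono[OF Suc, of n] fle_trans by auto
  qed simp
  \<comment> \<open>This and \<open>P_F\<close> interleave the sequences: \<open>P (Suc n)\<close>
    is below \<open>F n (P n)\<close>, which is below \<open>P n\<close>, so both have the limit
    \<open>q\<close>.\<close>
  have F_P: "fle S (F n (P n)) (P n)" for n
  proof -
    have "fle S ((F n ^^ n) (F n ?e)) ((F n ^^ n) ?e)"
      by (rule funpow_fle[OF F_ext[OF fle_refl] F_mono])
    then show ?thesis
      by (simp add: P_def funpow_swap1)
  qed
  have P_F: "fle S (P (Suc n)) (F n (P n))" for n
  proof -
    have "fle S ((F (Suc n) ^^ Suc n) ?e) ((F n ^^ Suc n) ?e)"
      by (rule pow_dec)
    then show ?thesis
      by (simp add: P_def)
  qed
  have P_dec: "fle S (P (Suc n)) (P n)" for n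
    using P_F F_P fle_trans by blast
  have "\<exists>s. dlim S (\<lambda>n. P n c) s" for c
    using P_dec by (intro dlim_exists) (simp add: fle_def)
  then obtain q where q: "\<And>c. dlim S (\<lambda>n. P n c) (q c)"
    by metis
  \<comment> \<open>The induction hypothesis along the moving valuation computes the same limit as
    the body at \<open>q\<close>; uniqueness of limits makes \<open>q\<close> a fixpoint.\<close>
  have "dlim S (\<lambda>n. F n (P n) c) (sem S \<gamma> \<phi> (W(x := q)) c)" for c
    unfolding F_def using Nu.prems(4,5) q pow_ext wf
    by (intro Nu.IH) (auto simp: P_def)
  moreover have "dlim S (\<lambda>n. F n (P n) c) (q c)" for c
  proof (rule dlimI)
    fix n
    show "sle S (F (Suc n) (P (Suc n)) c) (F n (P n) c)"
      using F_P P_F fle_trans unfolding fle_def by meson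
    show "sle S (q c) (F n (P n) c)"
      using dlim_lower[OF q, of c "Suc n"] P_F le_trans unfolding fle_def by blast
  next
    fix u assume "\<And>n. sle S u (F n (P n) c)"
    then show "sle S u (q c)"
      using dlim_greatest[OF q] F_P le_trans unfolding fle_def by blast
  qed
  ultimately have fixed: "sem S \<gamma> \<phi> (W(x := q)) = q"
    using dlim_unique by blast
  have "sem S \<gamma> (Nu x \<phi>) W = q"
    unfolding sem.simps
  proof (rule greatest_fixpoint_eqI, rule fixed)
    fix r assume r: "sem S \<gamma> \<phi> (W(x := r)) = r"
    \<comment> \<open>Guardedness enters here: every fixpoint lies below the starting point of the
      iteration.\<close>
    have r_ext: "fle S r ?e"
      by (rule guarded_fixpoint_le_ext[OF wf W_ext r])
    have r_F: "fle S r (F n r)" for n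
    proof -
      \<comment> \<open>For a constant valuation the approximants decrease to the semantics, here
        \<open>r\<close>, so each of them is above \<open>r\<close>.\<close>
      have "dlim S (\<lambda>n. approx S \<gamma> n \<phi> (W(x := r)) c) (sem S \<gamma> \<phi> (W(x := r)) c)" for c
        using wf W_ext r_ext by (intro Nu.IH) (auto intro: dlim_const)
      then have "fle S r (approx S \<gamma> n \<phi> (W(x := r)))"
        unfolding r fle_def using dlim_lower by blast
      moreover have "fle S (approx S \<gamma> n \<phi> (W(x := r))) (F n r)"
        unfolding F_def using W_V by (intro approx_mono) auto
      ultimately show ?thesis
        by (rule fle_trans)
    qed
    have "fle S r ((F n ^^ m) ?e)" for n m
    proof (induction m)
      case (Suc m)
      then show ?case
        using fle_trans[OF r_F F_mono] by simp
    qed (simp add: r_ext)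
    then show "fle S r q"
      unfolding P_def[symmetric] fle_def using q dlim_greatest unfolding P_def fle_def by blast
  qed
  moreover have "approx S \<gamma> n (Nu x \<phi>) (V n) = P n" for n
    by (simp add: P_def F_def[abs_def])
  ultimately show ?case
    using q by (simp del: sem.simps approx.simps)
qed (auto intro: dlim_const)

text \<open>\<open>T\<close> contains the extent, as the behaviour on \<open>Empty\<close>, and is
  closed under modalities: a zero argument gives zero, and otherwise the fragments of the arguments
  are joined by a \<open>Node\<close>. Hence iteration stays in \<open>T\<close>.\<close>

lemma approx_fragment:
  fixes V :: "'v \<Rightarrow> 'c \<Rightarrow> 's"
  defines "T \<equiv> insert (\<lambda>_. zero S) ((\<lambda>b c. lt S \<gamma> (c, b)) ` fragments \<Lambda> ar)"
  shows "wf_fm S \<Lambda> ar \<phi> \<Longrightarrow> (\<And>x. V x \<in> T) \<Longrightarrow> approx S \<gamma> n \<phi> V \<in> T"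
proof (induction \<phi> arbitrary: V)
  case Top
  have "(\<lambda>c. lt S \<gamma> (c, Empty)) \<in> T"
    unfolding T_def using fragments.intros(1) by blast
  then show ?case
    by (simp add: lt_Empty)
next
  case (Modal l \<phi>s)
  let ?h = "\<lambda>\<phi>. approx S \<gamma> n \<phi> V"
  show ?case
  proof (cases "\<exists>\<psi>\<in>set \<phi>s. ?h \<psi> = (\<lambda>_. zero S)")
    case True
    then have "approx S \<gamma> n (Modal l \<phi>s) V = (\<lambda>_. zero S)"
      using modality_strict[of _ \<phi>s ?h l] Modal.prems by auto
    then show ?thesis
      by (simp add: T_def)
  next
    case False
    have "\<exists>b\<in>fragments \<Lambda> ar. ?h \<psi> = (\<lambda>c. lt S \<gamma> (c, b))" if "\<psi> \<in> set \<phi>s" for \<psi>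
    proof -
      have "?h \<psi> \<in> T"
        using Modal.prems that by (intro Modal.IH) auto
      then show ?thesis
        using False that unfolding T_def by blast
    qed
    then obtain b where b: "\<And>\<psi>. \<psi> \<in> set \<phi>s \<Longrightarrow> b \<psi> \<in> fragments \<Lambda> ar \<and> ?h \<psi> = (\<lambda>c. lt S \<gamma> (c, b \<psi>))"
      by metis
    then have "Node l (map b \<phi>s) \<in> fragments \<Lambda> ar"
      using Modal.prems by (intro fragments.intros) auto
    moreover have "map ?h \<phi>s = map (\<lambda>b c. lt S \<gamma> (c, b)) (map b \<phi>s)"
      using b by simp
    then have "approx S \<gamma> n (Modal l \<phi>s) V = (\<lambda>c. lt S \<gamma> (c, Node l (map b \<phi>s)))"
      by (simp only: approx.simps lt_Node)
    ultimately show ?thesis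
      unfolding T_def by blast
  qed
next
  case (Nu x \<phi>)
  have "(\<lambda>c. lt S \<gamma> (c, Empty)) \<in> T"
    unfolding T_def using fragments.intros(1) by blast
  then have "ext S \<gamma> \<in> T"
    by (simp add: lt_Empty)
  then have "((\<lambda>p. approx S \<gamma> n \<phi> (V(x := p))) ^^ m) (ext S \<gamma>) \<in> T" for m
    using Nu by (induction m) auto
  then show ?case by simp
qed (auto simp: T_def)

end

theorem theorem6p4:
  fixes S :: "'s psemiring" and \<Lambda> :: "'l set" and ar :: "'l \<Rightarrow> nat"
    and \<gamma> :: "('c, 'l, 's) coalg" and c d :: 'c
    and \<phi> :: "('s, 'l, 'v) fm" and V :: "'v \<Rightarrow> 'c \<Rightarrow> 's"
  assumes "continuous_semiring S"
    and "coalgebra S \<Lambda> ar \<gamma>"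
    and "lt_equiv S \<Lambda> ar \<gamma> c d"
    and "\<phi> \<in> muL0 S \<Lambda> ar"
    and "nu_guarded \<phi>"
  shows "sem S \<gamma> \<phi> V c = sem S \<gamma> \<phi> V d"
proof -
  interpret weighted_coalgebra S \<Lambda> ar \<gamma>
    using assms by (simp add: weighted_coalgebra_def weighted_coalgebra_axioms_def)
  \<comment> \<open>This valuation is below the extent, as \<open>dlim_approx\<close> requires, and
    in the set of \<open>approx_fragment\<close>. Closedness of the formula transfers the result to
    \<open>V\<close>.\<close>
  let ?E = "\<lambda>_ :: 'v. ext S \<gamma>"
  have \<phi>: "wf_fm S \<Lambda> ar \<phi>" "fv \<phi> = {}" "only_bot_sums \<phi>"
    using assms(4) by (auto simp: muL0_def)
  have lim: "dlim S (\<lambda>n. approx S \<gamma> n \<phi> ?E a) (sem S \<gamma> \<phi> ?E a)" for a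
    using \<phi> assms(5) by (intro dlim_approx) (auto intro: dlim_const)
  have "ext S \<gamma> \<in> (\<lambda>b c. lt S \<gamma> (c, b)) ` fragments \<Lambda> ar"
    using fragments.intros(1) lt_Empty by (intro image_eqI[of _ _ Empty]) auto
  then have in_T: "approx S \<gamma> n \<phi> ?E \<in> insert (\<lambda>_. zero S) ((\<lambda>b c. lt S \<gamma> (c, b)) ` fragments \<Lambda> ar)" for n
    using \<phi>(1) by (intro approx_fragment) auto
  \<comment> \<open>Each approximant is zero or the behaviour on one fragment, and either takes the
    same value at \<open>c\<close> and \<open>d\<close>.\<close>
  have "approx S \<gamma> n \<phi> ?E c = approx S \<gamma> n \<phi> ?E d" for n
    using in_T[of n] assms(3) unfolding lt_equiv_def by auto
  then have "sem S \<gamma> \<phi> ?E c = sem S \<gamma> \<phi> ?E d"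
    using lim[of c] lim[of d] dlim_unique by simp
  moreover have "sem S \<gamma> \<phi> V = sem S \<gamma> \<phi> ?E"
    using \<phi>(2) by (intro sem_cong) simp
  ultimately show ?thesis by simp
qed

end
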